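(* Let $R$ be an associative ring with unity and let $\mathcal{X}$ be a class of $R$-modules that is closed under direct sums, direct summands and extensions. Let $C(\mathcal{X}^{*})$ be the class of all complexes of $R$-modules all of whose terms lie in $\mathcal{X}$, and assume that $C(\mathcal{X}^{*})$ is closed under inverse limits and direct limits. If every $R$-module has an $\mathcal{X}$-envelope, then every complex of $R$-modules has a $C(\mathcal{X}^{*})$-envelope.
   Context: Complexes are indexed by $\mathbb{Z}$ and may be unbounded. $C(\mathcal{X}^{*})$ is regarded as a class of objects in the abelian category of complexes of $R$-modules with chain maps as morphisms; limits are taken in that category. Closed under extensions means: if $0\to A\to B\to C\to 0$ is exact with $A,C\in\mathcal{X}$, then $B\in\mathcal{X}$. Let $\mathcal{A}$ be an abelian category, $\mathcal{Y}$ a class of objects of $\mathcal{A}$, and $M$ an object of $\mathcal{A}$. A morphism $\phi: M\to Y$ with $Y\in\mathcal{Y}$ is a $\mathcal{Y}$-preenvelope of $M$ if for every morphism $f: M\to Y'$ with $Y'\in\mathcal{Y}$ there is $g: Y\to Y'$ with $g\phi=f$. It is a $\mathcal{Y}$-envelope if moreover every endomorphism $g: Y\to Y$ with $g\phi=\phi$ is an automorphism. An $\mathcal{X}$-envelope of a module is taken in the category of $R$-modules; a $C(\mathcal{X}^{*})$-envelope of a complex is taken in the category of complexes. *)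

theory Defs
  imports "HOL-Algebra.Module"
begin

section \<open>Universes\<close>

text \<open>
  A class of modules cannot range over all types at once. We therefore work inside a type 'm with
  a family U of "small" subsets of 'm which serve as the underlying sets of the modules under
  consideration and as the index sets of direct sums and limits. The axioms are those of a
  Grothendieck universe (up to bijection) without the power set axiom. They are satisfied by the
  small sets over a type of ZFC sets, in which case the notions below are literally those of
  ordinary mathematics, and also, for example, by all subsets of any infinite type.
\<close>

locale module_universe =
  fixes U :: "'m set set"
  assumes subset_closed: "A \<in> U \<Longrightarrow> B \<subseteq> A \<Longrightarrow> B \<in> U"
    and image_closed: "A \<in> U \<Longrightarrow> f ` A \<in> U"
    and Union_closed: "\<And>A (B :: 'm \<Rightarrow> 'm set).
      A \<in> U \<Longrightarrow> (\<And>a. a \<in> A \<Longrightarrow> B a \<in> U) \<Longrightarrow> (\<Union>a\<in>A. B a) \<in> U"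
    and infinite_mem: "\<exists>A\<in>U. infinite A"

lemma module_universe_UNIV: "infinite (UNIV :: 'm set) \<Longrightarrow> module_universe (UNIV :: 'm set set)"
  by unfold_locales auto


section \<open>Categories, envelopes and limits\<close>

text \<open>
  \<open>Comp C A g f\<close> is the composite g f of a morphism f with source A and a morphism g; the source
  is an argument because morphisms are going to be extensional functions.
\<close>

record ('o, 'a) cat =
  Ob :: "'o set"
  Hom :: "'o \<Rightarrow> 'o \<Rightarrow> 'a set"
  Comp :: "'o \<Rightarrow> 'a \<Rightarrow> 'a \<Rightarrow> 'a"
  Ident :: "'o \<Rightarrow> 'a"

locale is_category =
  fixes C :: "('o, 'a) cat"
  assumes Ident_Hom: "A \<in> Ob C \<Longrightarrow> Ident C A \<in> Hom C A A"
    and Comp_Hom: "\<lbrakk>A \<in> Ob C; B \<in> Ob C; D \<in> Ob C; f \<in> Hom C A B; g \<in> Hom C B D\<rbrakk>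
      \<Longrightarrow> Comp C A g f \<in> Hom C A D"
    and Comp_Ident: "\<lbrakk>A \<in> Ob C; B \<in> Ob C; f \<in> Hom C A B\<rbrakk> \<Longrightarrow> Comp C A f (Ident C A) = f"
    and Ident_Comp: "\<lbrakk>A \<in> Ob C; B \<in> Ob C; f \<in> Hom C A B\<rbrakk> \<Longrightarrow> Comp C A (Ident C B) f = f"
    and Comp_assoc: "\<lbrakk>A \<in> Ob C; B \<in> Ob C; D \<in> Ob C; E \<in> Ob C;
        f \<in> Hom C A B; g \<in> Hom C B D; h \<in> Hom C D E\<rbrakk>
      \<Longrightarrow> Comp C A h (Comp C A g f) = Comp C A (Comp C B h g) f"

definition automorphism :: "('o, 'a) cat \<Rightarrow> 'o \<Rightarrow> 'a \<Rightarrow> bool" where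
  "automorphism C Y g \<longleftrightarrow> g \<in> Hom C Y Y \<and>
     (\<exists>h \<in> Hom C Y Y. Comp C Y h g = Ident C Y \<and> Comp C Y g h = Ident C Y)"

definition is_preenvelope :: "('o, 'a) cat \<Rightarrow> 'o set \<Rightarrow> 'o \<Rightarrow> 'o \<Rightarrow> 'a \<Rightarrow> bool" where
  "is_preenvelope C Ys M Y \<phi> \<longleftrightarrow> Y \<in> Ys \<and> \<phi> \<in> Hom C M Y \<and>
     (\<forall>Y' \<in> Ys. \<forall>f \<in> Hom C M Y'. \<exists>g \<in> Hom C Y Y'. Comp C M g \<phi> = f)"

definition is_envelope :: "('o, 'a) cat \<Rightarrow> 'o set \<Rightarrow> 'o \<Rightarrow> 'o \<Rightarrow> 'a \<Rightarrow> bool" where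
  "is_envelope C Ys M Y \<phi> \<longleftrightarrow> is_preenvelope C Ys M Y \<phi> \<and>
     (\<forall>g \<in> Hom C Y Y. Comp C M g \<phi> = \<phi> \<longrightarrow> automorphism C Y g)"

definition has_envelope :: "('o, 'a) cat \<Rightarrow> 'o set \<Rightarrow> 'o \<Rightarrow> bool" where
  "has_envelope C Ys M \<longleftrightarrow> (\<exists>Y \<phi>. is_envelope C Ys M Y \<phi>)"

definition directed_poset :: "'i set \<Rightarrow> 'i rel \<Rightarrow> bool" where
  "directed_poset I r \<longleftrightarrow> partial_order_on I r \<and> I \<noteq> {} \<and>
     (\<forall>i\<in>I. \<forall>j\<in>I. \<exists>k\<in>I. (i, k) \<in> r \<and> (j, k) \<in> r)"

text \<open>In a direct system \<open>u i j\<close> goes from \<open>D i\<close> to \<open>D j\<close>, where (i, j) is in r, that is, i is at most j.\<close>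

definition direct_system ::
    "('o, 'a) cat \<Rightarrow> 'i set \<Rightarrow> 'i rel \<Rightarrow> ('i \<Rightarrow> 'o) \<Rightarrow> ('i \<Rightarrow> 'i \<Rightarrow> 'a) \<Rightarrow> bool" where
  "direct_system C I r D u \<longleftrightarrow> directed_poset I r \<and>
     (\<forall>i\<in>I. D i \<in> Ob C) \<and>
     (\<forall>(i, j)\<in>r. u i j \<in> Hom C (D i) (D j)) \<and>
     (\<forall>i\<in>I. u i i = Ident C (D i)) \<and>
     (\<forall>i j k. (i, j) \<in> r \<longrightarrow> (j, k) \<in> r \<longrightarrow> Comp C (D i) (u j k) (u i j) = u i k)"

definition is_cocone ::
    "('o, 'a) cat \<Rightarrow> 'i set \<Rightarrow> 'i rel \<Rightarrow> ('i \<Rightarrow> 'o) \<Rightarrow> ('i \<Rightarrow> 'i \<Rightarrow> 'a) \<Rightarrow> 'o \<Rightarrow> ('i \<Rightarrow> 'a) \<Rightarrow> bool" where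
  "is_cocone C I r D u L \<iota> \<longleftrightarrow> L \<in> Ob C \<and>
     (\<forall>i\<in>I. \<iota> i \<in> Hom C (D i) L) \<and>
     (\<forall>(i, j)\<in>r. Comp C (D i) (\<iota> j) (u i j) = \<iota> i)"

definition is_direct_limit ::
    "('o, 'a) cat \<Rightarrow> 'i set \<Rightarrow> 'i rel \<Rightarrow> ('i \<Rightarrow> 'o) \<Rightarrow> ('i \<Rightarrow> 'i \<Rightarrow> 'a) \<Rightarrow> 'o \<Rightarrow> ('i \<Rightarrow> 'a) \<Rightarrow> bool" where
  "is_direct_limit C I r D u L \<iota> \<longleftrightarrow> direct_system C I r D u \<and> is_cocone C I r D u L \<iota> \<and>
     (\<forall>T \<tau>. is_cocone C I r D u T \<tau> \<longrightarrow>
        (\<exists>!h. h \<in> Hom C L T \<and> (\<forall>i\<in>I. Comp C (D i) h (\<iota> i) = \<tau> i)))"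

text \<open>In an inverse system \<open>u i j\<close> goes from \<open>D j\<close> to \<open>D i\<close>, where again i is at most j.\<close>

definition inverse_system ::
    "('o, 'a) cat \<Rightarrow> 'i set \<Rightarrow> 'i rel \<Rightarrow> ('i \<Rightarrow> 'o) \<Rightarrow> ('i \<Rightarrow> 'i \<Rightarrow> 'a) \<Rightarrow> bool" where
  "inverse_system C I r D u \<longleftrightarrow> directed_poset I r \<and>
     (\<forall>i\<in>I. D i \<in> Ob C) \<and>
     (\<forall>(i, j)\<in>r. u i j \<in> Hom C (D j) (D i)) \<and>
     (\<forall>i\<in>I. u i i = Ident C (D i)) \<and>
     (\<forall>i j k. (i, j) \<in> r \<longrightarrow> (j, k) \<in> r \<longrightarrow> Comp C (D k) (u i j) (u j k) = u i k)"

definition is_cone ::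
    "('o, 'a) cat \<Rightarrow> 'i set \<Rightarrow> 'i rel \<Rightarrow> ('i \<Rightarrow> 'o) \<Rightarrow> ('i \<Rightarrow> 'i \<Rightarrow> 'a) \<Rightarrow> 'o \<Rightarrow> ('i \<Rightarrow> 'a) \<Rightarrow> bool" where
  "is_cone C I r D u L \<pi> \<longleftrightarrow> L \<in> Ob C \<and>
     (\<forall>i\<in>I. \<pi> i \<in> Hom C L (D i)) \<and>
     (\<forall>(i, j)\<in>r. Comp C L (u i j) (\<pi> j) = \<pi> i)"

definition is_inverse_limit ::
    "('o, 'a) cat \<Rightarrow> 'i set \<Rightarrow> 'i rel \<Rightarrow> ('i \<Rightarrow> 'o) \<Rightarrow> ('i \<Rightarrow> 'i \<Rightarrow> 'a) \<Rightarrow> 'o \<Rightarrow> ('i \<Rightarrow> 'a) \<Rightarrow> bool" where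
  "is_inverse_limit C I r D u L \<pi> \<longleftrightarrow> inverse_system C I r D u \<and> is_cone C I r D u L \<pi> \<and>
     (\<forall>T \<tau>. is_cone C I r D u T \<tau> \<longrightarrow>
        (\<exists>!h. h \<in> Hom C T L \<and> (\<forall>i\<in>I. Comp C T (\<pi> i) h = \<tau> i)))"

definition closed_under_direct_limits :: "'i set set \<Rightarrow> ('o, 'a) cat \<Rightarrow> 'o set \<Rightarrow> bool" where
  "closed_under_direct_limits U C Ys \<longleftrightarrow>
     (\<forall>I \<in> U. \<forall>r D u L \<iota>. is_direct_limit C I r D u L \<iota> \<longrightarrow> (\<forall>i\<in>I. D i \<in> Ys) \<longrightarrow> L \<in> Ys)"

definition closed_under_inverse_limits :: "'i set set \<Rightarrow> ('o, 'a) cat \<Rightarrow> 'o set \<Rightarrow> bool" where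
  "closed_under_inverse_limits U C Ys \<longleftrightarrow>
     (\<forall>I \<in> U. \<forall>r D u L \<pi>. is_inverse_limit C I r D u L \<pi> \<longrightarrow> (\<forall>i\<in>I. D i \<in> Ys) \<longrightarrow> L \<in> Ys)"


section \<open>Modules over a not necessarily commutative ring\<close>

text \<open>
  The library locale \<open>module\<close> requires a commutative ring. We keep its record type; the
  components \<open>mult\<close> and \<open>one\<close> of that record play no role for modules.
\<close>

locale left_module = R?: ring R + M?: abelian_group M
  for R :: "('r, 'k) ring_scheme" (structure) and M :: "('r, 'm) module" (structure) +
  assumes smult_closed:
      "\<lbrakk>a \<in> carrier R; x \<in> carrier M\<rbrakk> \<Longrightarrow> a \<odot>\<^bsub>M\<^esub> x \<in> carrier M"
    and smult_l_distr: "\<lbrakk>a \<in> carrier R; b \<in> carrier R; x \<in> carrier M\<rbrakk> \<Longrightarrow>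
      (a \<oplus>\<^bsub>R\<^esub> b) \<odot>\<^bsub>M\<^esub> x = a \<odot>\<^bsub>M\<^esub> x \<oplus>\<^bsub>M\<^esub> b \<odot>\<^bsub>M\<^esub> x"
    and smult_r_distr: "\<lbrakk>a \<in> carrier R; x \<in> carrier M; y \<in> carrier M\<rbrakk> \<Longrightarrow>
      a \<odot>\<^bsub>M\<^esub> (x \<oplus>\<^bsub>M\<^esub> y) = a \<odot>\<^bsub>M\<^esub> x \<oplus>\<^bsub>M\<^esub> a \<odot>\<^bsub>M\<^esub> y"
    and smult_assoc1: "\<lbrakk>a \<in> carrier R; b \<in> carrier R; x \<in> carrier M\<rbrakk> \<Longrightarrow>
      (a \<otimes>\<^bsub>R\<^esub> b) \<odot>\<^bsub>M\<^esub> x = a \<odot>\<^bsub>M\<^esub> (b \<odot>\<^bsub>M\<^esub> x)"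
    and smult_one: "x \<in> carrier M \<Longrightarrow> \<one>\<^bsub>R\<^esub> \<odot>\<^bsub>M\<^esub> x = x"

lemma left_module_cring:
  assumes "cring R"
  shows "left_module R M \<longleftrightarrow> module R M"
  using assms
  by (auto simp: left_module_def left_module_axioms_def module_def module_axioms_def cring_def)

text \<open>Homomorphisms are extensional, so that equality of morphisms is equality of functions.\<close>

definition module_hom ::
    "('r, 'k) ring_scheme \<Rightarrow> ('r, 'm) module \<Rightarrow> ('r, 'n) module \<Rightarrow> ('m \<Rightarrow> 'n) set" where
  "module_hom R M N = {f \<in> carrier M \<rightarrow>\<^sub>E carrier N.
     (\<forall>x\<in>carrier M. \<forall>y\<in>carrier M. f (x \<oplus>\<^bsub>M\<^esub> y) = f x \<oplus>\<^bsub>N\<^esub> f y) \<and>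
     (\<forall>a\<in>carrier R. \<forall>x\<in>carrier M. f (a \<odot>\<^bsub>M\<^esub> x) = a \<odot>\<^bsub>N\<^esub> f x)}"

definition module_iso ::
    "('r, 'k) ring_scheme \<Rightarrow> ('r, 'm) module \<Rightarrow> ('r, 'n) module \<Rightarrow> bool" where
  "module_iso R M N \<longleftrightarrow> (\<exists>f \<in> module_hom R M N. bij_betw f (carrier M) (carrier N))"

definition direct_sum :: "'i set \<Rightarrow> ('i \<Rightarrow> ('r, 'm) module) \<Rightarrow> ('r, 'i \<Rightarrow> 'm) module" where
  "direct_sum I M =
    \<lparr>carrier = {x \<in> \<Pi>\<^sub>E i\<in>I. carrier (M i). finite {i\<in>I. x i \<noteq> \<zero>\<^bsub>M i\<^esub>}},
     mult = (\<lambda>x y. \<lambda>i\<in>I. x i \<otimes>\<^bsub>M i\<^esub> y i),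
     one = (\<lambda>i\<in>I. \<one>\<^bsub>M i\<^esub>),
     zero = (\<lambda>i\<in>I. \<zero>\<^bsub>M i\<^esub>),
     add = (\<lambda>x y. \<lambda>i\<in>I. x i \<oplus>\<^bsub>M i\<^esub> y i),
     smult = (\<lambda>a x. \<lambda>i\<in>I. a \<odot>\<^bsub>M i\<^esub> x i)\<rparr>"

definition MOD :: "('r, 'k) ring_scheme \<Rightarrow> 'm set set \<Rightarrow> (('r, 'm) module, 'm \<Rightarrow> 'm) cat" where
  "MOD R U =
    \<lparr>Ob = {M. left_module R M \<and> carrier M \<in> U},
     Hom = module_hom R,
     Comp = (\<lambda>M g f. compose (carrier M) g f),
     Ident = (\<lambda>M. \<lambda>x\<in>carrier M. x)\<rparr>"

text \<open>
  A direct sum lives on a function type, so "the direct sum lies in \<open>Xs\<close>" means that every module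
  of the universe isomorphic to it does; likewise for direct summands. In particular, a class
  closed under direct summands is closed under isomorphism.
\<close>

definition closed_under_direct_sums ::
    "('r, 'k) ring_scheme \<Rightarrow> 'm set set \<Rightarrow> ('r, 'm) module set \<Rightarrow> bool" where
  "closed_under_direct_sums R U Xs \<longleftrightarrow>
     (\<forall>I \<in> U. \<forall>M :: 'm \<Rightarrow> ('r, 'm) module. \<forall>S \<in> Ob (MOD R U).
        (\<forall>i\<in>I. M i \<in> Xs) \<longrightarrow> module_iso R S (direct_sum I M) \<longrightarrow> S \<in> Xs)"

definition closed_under_direct_summands ::
    "('r, 'k) ring_scheme \<Rightarrow> 'm set set \<Rightarrow> ('r, 'm) module set \<Rightarrow> bool" where
  "closed_under_direct_summands R U Xs \<longleftrightarrow>
     (\<forall>M \<in> Xs. \<forall>N \<in> Ob (MOD R U). \<forall>N' \<in> Ob (MOD R U).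
        module_iso R M (direct_sum (UNIV :: bool set) (\<lambda>b. if b then N else N')) \<longrightarrow> N \<in> Xs)"

definition short_exact ::
    "('r, 'k) ring_scheme \<Rightarrow> ('r, 'm) module \<Rightarrow> ('r, 'm) module \<Rightarrow> ('r, 'm) module \<Rightarrow>
      ('m \<Rightarrow> 'm) \<Rightarrow> ('m \<Rightarrow> 'm) \<Rightarrow> bool" where
  "short_exact R A B C f g \<longleftrightarrow> f \<in> module_hom R A B \<and> g \<in> module_hom R B C \<and>
     inj_on f (carrier A) \<and> f ` carrier A = {x \<in> carrier B. g x = \<zero>\<^bsub>C\<^esub>} \<and>
     g ` carrier B = carrier C"

definition closed_under_extensions ::
    "('r, 'k) ring_scheme \<Rightarrow> 'm set set \<Rightarrow> ('r, 'm) module set \<Rightarrow> bool" where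
  "closed_under_extensions R U Xs \<longleftrightarrow>
     (\<forall>A \<in> Xs. \<forall>C \<in> Xs. \<forall>B \<in> Ob (MOD R U). \<forall>f g. short_exact R A B C f g \<longrightarrow> B \<in> Xs)"


section \<open>Complexes of modules\<close>

text \<open>Homological indexing: \<open>cdiff K n\<close> goes from \<open>cterm K n\<close> to \<open>cterm K (n - 1)\<close>.\<close>

record ('r, 'm) chain_cplx =
  cterm :: "int \<Rightarrow> ('r, 'm) module"
  cdiff :: "int \<Rightarrow> 'm \<Rightarrow> 'm"

definition is_complex ::
    "('r, 'k) ring_scheme \<Rightarrow> 'm set set \<Rightarrow> ('r, 'm) chain_cplx \<Rightarrow> bool" where
  "is_complex R U K \<longleftrightarrow>
     (\<forall>n. cterm K n \<in> Ob (MOD R U)) \<and>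
     (\<forall>n. cdiff K n \<in> module_hom R (cterm K n) (cterm K (n - 1))) \<and>
     (\<forall>n. \<forall>x \<in> carrier (cterm K n). cdiff K (n - 1) (cdiff K n x) = \<zero>\<^bsub>cterm K (n - 1 - 1)\<^esub>)"

definition chain_maps ::
    "('r, 'k) ring_scheme \<Rightarrow> ('r, 'm) chain_cplx \<Rightarrow> ('r, 'm) chain_cplx \<Rightarrow> (int \<Rightarrow> 'm \<Rightarrow> 'm) set" where
  "chain_maps R K L = {f.
     (\<forall>n. f n \<in> module_hom R (cterm K n) (cterm L n)) \<and>
     (\<forall>n. \<forall>x \<in> carrier (cterm K n). cdiff L n (f n x) = f (n - 1) (cdiff K n x))}"

definition CPLX ::
    "('r, 'k) ring_scheme \<Rightarrow> 'm set set \<Rightarrow> (('r, 'm) chain_cplx, int \<Rightarrow> 'm \<Rightarrow> 'm) cat" where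
  "CPLX R U =
    \<lparr>Ob = {K. is_complex R U K},
     Hom = chain_maps R,
     Comp = (\<lambda>K g f n. compose (carrier (cterm K n)) (g n) (f n)),
     Ident = (\<lambda>K n. \<lambda>x\<in>carrier (cterm K n). x)\<rparr>"

definition complexes_in ::
    "('r, 'k) ring_scheme \<Rightarrow> 'm set set \<Rightarrow> ('r, 'm) module set \<Rightarrow> ('r, 'm) chain_cplx set" where
  "complexes_in R U Xs = {K. is_complex R U K \<and> (\<forall>n. cterm K n \<in> Xs)}"


section \<open>Modules and complexes form categories\<close>

lemma module_hom_compose:
  assumes "f \<in> module_hom R A B" "g \<in> module_hom R B D" "left_module R A"
  shows "compose (carrier A) g f \<in> module_hom R A D"
proof -
  interpret A: left_module R A by fact
  have f: "f x \<in> carrier B" if "x \<in> carrier A" for x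
    using assms(1) that by (auto simp: module_hom_def)
  show ?thesis
    using assms f unfolding module_hom_def
    by (auto simp: compose_eq A.smult_closed PiE_iff)
qed

lemma is_category_MOD: "is_category (MOD R U)"
proof
  show "Ident (MOD R U) A \<in> Hom (MOD R U) A A" if "A \<in> Ob (MOD R U)" for A
  proof -
    from that interpret A: left_module R A by (simp add: MOD_def)
    show ?thesis by (auto simp: MOD_def module_hom_def A.smult_closed)
  qed
qed (auto simp: MOD_def intro: module_hom_compose,
     auto simp: module_hom_def compose_def fun_eq_iff PiE_iff extensional_def)

lemma is_category_CPLX: "is_category (CPLX R U)"
proof
  show "Ident (CPLX R U) A \<in> Hom (CPLX R U) A A" if "A \<in> Ob (CPLX R U)" for A
  proof -
    have "(\<lambda>x\<in>carrier (cterm A n). x) \<in> module_hom R (cterm A n) (cterm A n)" for n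
      using is_category.Ident_Hom[OF is_category_MOD, of "cterm A n" R U] that
      by (auto simp: CPLX_def MOD_def is_complex_def)
    moreover have "cdiff A n x \<in> carrier (cterm A (n - 1))" if "x \<in> carrier (cterm A n)" for n x
      using \<open>A \<in> Ob (CPLX R U)\<close> that by (auto simp: CPLX_def is_complex_def module_hom_def)
    ultimately show ?thesis by (auto simp: CPLX_def chain_maps_def)
  qed
  show "Comp (CPLX R U) A g f \<in> Hom (CPLX R U) A D"
    if "A \<in> Ob (CPLX R U)" "B \<in> Ob (CPLX R U)" "D \<in> Ob (CPLX R U)"
      "f \<in> Hom (CPLX R U) A B" "g \<in> Hom (CPLX R U) B D" for A B D f g
  proof -
    have "cdiff A n x \<in> carrier (cterm A (n - 1))" if "x \<in> carrier (cterm A n)" for n x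
      using \<open>A \<in> Ob (CPLX R U)\<close> that by (auto simp: CPLX_def is_complex_def module_hom_def)
    moreover have "f n x \<in> carrier (cterm B n)" if "x \<in> carrier (cterm A n)" for n x
      using \<open>f \<in> Hom (CPLX R U) A B\<close> that by (auto simp: CPLX_def chain_maps_def module_hom_def)
    ultimately show ?thesis
      using that
      by (auto simp: CPLX_def chain_maps_def is_complex_def MOD_def compose_eq intro: module_hom_compose)
  qed
qed (auto simp: CPLX_def chain_maps_def module_hom_def compose_def fun_eq_iff PiE_iff extensional_def)

end

theory Submission
  imports Defs "HOL-Algebra.Free_Abelian_Groups"
begin

text \<open>
  The hypotheses make \<open>Xs\<close> a reflective class of modules, and then envelopes of complexes exist for
  formal reasons.

  The key point is that \<open>Xs\<close> is closed under kernels (\<open>kernel_closed\<close>). Let \<open>f\<close> be a homomorphism from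
  \<open>A\<close> to \<open>B\<close>, both in \<open>Xs\<close>. In the direct sum of \<open>A\<close> and countably many copies of \<open>B\<close>, with
  elements \<open>(x, y\<^sub>0, y\<^sub>1, \<dots>)\<close>, let \<open>S n\<close> be the submodule in which \<open>y\<^sub>m = f x\<close> for all \<open>m < n\<close>.
  Dropping the determined coordinates shows that \<open>S n\<close> is isomorphic to the direct sum of \<open>A\<close> and the
  remaining copies of \<open>B\<close>, so it lies in \<open>Xs\<close>. The submodules \<open>S n\<close> decrease, and in their
  intersection all coordinates \<open>y\<^sub>m\<close> equal \<open>f x\<close>; as only finitely many coordinates are nonzero,
  \<open>f x = 0\<close> there. So the inverse limit of the \<open>S n\<close> is the kernel of \<open>f\<close>. This is Bergman's
  device for writing an arbitrary module as an inverse limit of injective ones. Closure under inverse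
  limits is assumed for complexes; it passes to modules because a module can be viewed as the complex
  which equals it in every degree and has zero differential (\<open>closed_under_inverse_limits_MOD\<close>).

  Closure under kernels turns an envelope \<open>\<phi>\<close> of \<open>M\<close> into a reflection
  (\<open>envelope_factorisation_unique\<close>): if \<open>a\<close> and \<open>b\<close> agree on the image of \<open>\<phi>\<close>, then \<open>\<phi>\<close> factors
  through the kernel \<open>E\<close> of \<open>a - b\<close>; extending \<open>\<phi>\<close> along itself to a map into \<open>E\<close> gives an
  endomorphism which fixes \<open>\<phi>\<close>, hence is an automorphism, and has image in \<open>E\<close>. So \<open>E\<close> is everything
  and \<open>a = b\<close>.

  Finally, take envelopes of the terms of a complex. Factorisation through them supplies the
  differentials and the extensions of maps degree by degree. Its uniqueness gives \<open>d d = 0\<close>, the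
  compatibility of the extended maps with the differentials, and the fact that the only endomorphism
  fixing the resulting chain map is the identity.
\<close>

section \<open>Homomorphisms, submodules, direct sums and transport of structure\<close>

lemma (in left_module) smult_zero_right:
  assumes "a \<in> carrier R"
  shows "a \<odot>\<^bsub>M\<^esub> \<zero>\<^bsub>M\<^esub> = \<zero>\<^bsub>M\<^esub>"
proof -
  have "a \<odot>\<^bsub>M\<^esub> \<zero>\<^bsub>M\<^esub> \<oplus>\<^bsub>M\<^esub> a \<odot>\<^bsub>M\<^esub> \<zero>\<^bsub>M\<^esub> = a \<odot>\<^bsub>M\<^esub> \<zero>\<^bsub>M\<^esub> \<oplus>\<^bsub>M\<^esub> \<zero>\<^bsub>M\<^esub>"
    using assms smult_r_distr[of a "\<zero>\<^bsub>M\<^esub>" "\<zero>\<^bsub>M\<^esub>"] by (simp add: smult_closed)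
  then show ?thesis using assms by (simp add: smult_closed)
qed

lemma (in left_module) smult_zero_left:
  assumes "x \<in> carrier M"
  shows "\<zero>\<^bsub>R\<^esub> \<odot>\<^bsub>M\<^esub> x = \<zero>\<^bsub>M\<^esub>"
proof -
  have "\<zero>\<^bsub>R\<^esub> \<odot>\<^bsub>M\<^esub> x \<oplus>\<^bsub>M\<^esub> \<zero>\<^bsub>R\<^esub> \<odot>\<^bsub>M\<^esub> x = \<zero>\<^bsub>R\<^esub> \<odot>\<^bsub>M\<^esub> x \<oplus>\<^bsub>M\<^esub> \<zero>\<^bsub>M\<^esub>"
    using assms smult_l_distr[of "\<zero>\<^bsub>R\<^esub>" "\<zero>\<^bsub>R\<^esub>" x] by (simp add: smult_closed)
  then show ?thesis using assms by (simp add: smult_closed)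
qed

lemma (in left_module) minus_one_smult:
  assumes "x \<in> carrier M"
  shows "(\<ominus>\<^bsub>R\<^esub> \<one>\<^bsub>R\<^esub>) \<odot>\<^bsub>M\<^esub> x \<oplus>\<^bsub>M\<^esub> x = \<zero>\<^bsub>M\<^esub>"
  using assms smult_l_distr[of "\<ominus>\<^bsub>R\<^esub> \<one>\<^bsub>R\<^esub>" "\<one>\<^bsub>R\<^esub>" x]
  by (simp add: smult_one smult_zero_left R.l_neg)

lemma (in left_module) smult_minus_right:
  assumes "a \<in> carrier R" "x \<in> carrier M"
  shows "a \<odot>\<^bsub>M\<^esub> (\<ominus>\<^bsub>M\<^esub> x) = \<ominus>\<^bsub>M\<^esub> (a \<odot>\<^bsub>M\<^esub> x)"
proof -
  have "a \<odot>\<^bsub>M\<^esub> (\<ominus>\<^bsub>M\<^esub> x) \<oplus>\<^bsub>M\<^esub> a \<odot>\<^bsub>M\<^esub> x = \<zero>\<^bsub>M\<^esub>"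
    using assms smult_r_distr[of a "\<ominus>\<^bsub>M\<^esub> x" x] by (simp add: smult_zero_right M.l_neg)
  then show ?thesis using assms by (simp add: smult_closed M.minus_equality)
qed

lemma (in abelian_group) minus_eq_zero_iff:
  assumes "x \<in> carrier G" "y \<in> carrier G"
  shows "x \<ominus> y = \<zero> \<longleftrightarrow> x = y"
  using assms minus_equality[of x "\<ominus> y"] by (auto simp: minus_eq r_neg)

lemma module_hom_ext:
  assumes "f \<in> module_hom R A B" "g \<in> module_hom R A B" "\<And>x. x \<in> carrier A \<Longrightarrow> f x = g x"
  shows "f = g"
  using assms by (auto simp: module_hom_def intro: PiE_ext)

lemma module_hom_closed: "f \<in> module_hom R A B \<Longrightarrow> x \<in> carrier A \<Longrightarrow> f x \<in> carrier B"
  by (auto simp: module_hom_def)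

lemma module_hom_add:
  "f \<in> module_hom R A B \<Longrightarrow> x \<in> carrier A \<Longrightarrow> y \<in> carrier A \<Longrightarrow> f (x \<oplus>\<^bsub>A\<^esub> y) = f x \<oplus>\<^bsub>B\<^esub> f y"
  by (auto simp: module_hom_def)

lemma module_hom_smult:
  "f \<in> module_hom R A B \<Longrightarrow> a \<in> carrier R \<Longrightarrow> x \<in> carrier A \<Longrightarrow> f (a \<odot>\<^bsub>A\<^esub> x) = a \<odot>\<^bsub>B\<^esub> f x"
  by (auto simp: module_hom_def)

lemma module_hom_zero:
  assumes "left_module R A" "left_module R B" "f \<in> module_hom R A B"
  shows "f \<zero>\<^bsub>A\<^esub> = \<zero>\<^bsub>B\<^esub>"
proof -
  interpret A: left_module R A by fact
  interpret B: left_module R B by fact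
  have "f (\<zero>\<^bsub>R\<^esub> \<odot>\<^bsub>A\<^esub> \<zero>\<^bsub>A\<^esub>) = \<zero>\<^bsub>R\<^esub> \<odot>\<^bsub>B\<^esub> f \<zero>\<^bsub>A\<^esub>"
    using assms(3) by (simp add: module_hom_smult)
  then show ?thesis
    using module_hom_closed[OF assms(3)] by (simp add: A.smult_zero_left B.smult_zero_left)
qed

lemma module_hom_diff:
  assumes "left_module R A" "left_module R B" "f \<in> module_hom R A B" "g \<in> module_hom R A B"
  shows "(\<lambda>x\<in>carrier A. f x \<ominus>\<^bsub>B\<^esub> g x) \<in> module_hom R A B"
proof -
  interpret A: left_module R A by fact
  interpret B: left_module R B by fact
  note h = assms(3,4)[THEN module_hom_closed] assms(3,4)[THEN module_hom_add]
    assms(3,4)[THEN module_hom_smult]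
  show ?thesis
    unfolding module_hom_def
    by (auto simp: h A.smult_closed B.minus_eq B.minus_add B.smult_r_distr B.smult_minus_right
        B.a_ac)
qed

lemma zero_in_module_hom:
  assumes "left_module R A" "left_module R B"
  shows "(\<lambda>x\<in>carrier A. \<zero>\<^bsub>B\<^esub>) \<in> module_hom R A B"
proof -
  interpret A: left_module R A by fact
  interpret B: left_module R B by fact
  show ?thesis
    unfolding module_hom_def by (auto simp: A.smult_closed B.smult_zero_right)
qed

lemma left_module_submodule:
  assumes "left_module R M" "S \<subseteq> carrier M" "\<zero>\<^bsub>M\<^esub> \<in> S"
    and add: "\<And>x y. x \<in> S \<Longrightarrow> y \<in> S \<Longrightarrow> x \<oplus>\<^bsub>M\<^esub> y \<in> S"
    and smult: "\<And>a x. a \<in> carrier R \<Longrightarrow> x \<in> S \<Longrightarrow> a \<odot>\<^bsub>M\<^esub> x \<in> S"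
  shows "left_module R (M\<lparr>carrier := S\<rparr>)"
proof -
  interpret M: left_module R M by fact
  have S: "x \<in> carrier M" if "x \<in> S" for x using that assms(2) by auto
  have "abelian_group (M\<lparr>carrier := S\<rparr>)"
  proof (rule abelian_groupI, simp_all add: add assms(3))
    fix x assume x: "x \<in> S"
    show "\<exists>y\<in>S. y \<oplus>\<^bsub>M\<^esub> x = \<zero>\<^bsub>M\<^esub>"
      by (rule bexI[of _ "(\<ominus>\<^bsub>R\<^esub> \<one>\<^bsub>R\<^esub>) \<odot>\<^bsub>M\<^esub> x"]) (use x S in \<open>auto simp: M.minus_one_smult smult\<close>)
  qed (auto simp: S M.a_ac)
  then show ?thesis
    by (intro left_module.intro left_module_axioms.intro)
      (auto simp: smult S M.smult_l_distr M.smult_r_distr M.smult_assoc1 M.smult_one M.R.ring_axioms)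
qed

lemma left_module_kernel:
  assumes "left_module R A" "left_module R B" "f \<in> module_hom R A B"
  shows "left_module R (A\<lparr>carrier := {x \<in> carrier A. f x = \<zero>\<^bsub>B\<^esub>}\<rparr>)"
proof -
  interpret A: left_module R A by fact
  interpret B: left_module R B by fact
  show ?thesis
    by (rule left_module_submodule)
      (auto simp: assms(1) module_hom_zero[OF assms] module_hom_add[OF assms(3)]
        module_hom_smult[OF assms(3)] A.smult_closed B.smult_zero_right)
qed

lemma left_module_direct_sum:
  assumes "ring R" "\<And>i. i \<in> I \<Longrightarrow> left_module R (M i)"
  shows "left_module R (direct_sum I M)"
proof -
  interpret R: ring R by fact
  note ab = assms(2)[THEN left_module.axioms(2)]
  note g = abelian_group.axioms(1)[OF ab]
  note ag = abelian_monoid.a_closed[OF g] abelian_monoid.zero_closed[OF g]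
    abelian_monoid.l_zero[OF g] abelian_monoid.a_assoc[OF g] abelian_group.a_inv_closed[OF ab]
    abelian_group.l_neg[OF ab]
  note sm = assms(2)[THEN left_module.smult_closed] assms(2)[THEN left_module.smult_zero_right]
  have add: "x \<oplus>\<^bsub>direct_sum I M\<^esub> y \<in> carrier (direct_sum I M)"
    if "x \<in> carrier (direct_sum I M)" "y \<in> carrier (direct_sum I M)" for x y
  proof -
    have "finite ({i\<in>I. x i \<noteq> \<zero>\<^bsub>M i\<^esub>} \<union> {i\<in>I. y i \<noteq> \<zero>\<^bsub>M i\<^esub>})"
      using that by (simp add: direct_sum_def)
    then have "finite {i\<in>I. x i \<oplus>\<^bsub>M i\<^esub> y i \<noteq> \<zero>\<^bsub>M i\<^esub>}"
      by (rule rev_finite_subset) (use ag in auto)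
    then show ?thesis
      using that by (auto simp: direct_sum_def ag PiE_iff cong: conj_cong)
  qed
  have smult: "a \<odot>\<^bsub>direct_sum I M\<^esub> x \<in> carrier (direct_sum I M)"
    if "a \<in> carrier R" "x \<in> carrier (direct_sum I M)" for a x
  proof -
    have "finite {i\<in>I. x i \<noteq> \<zero>\<^bsub>M i\<^esub>}"
      using that by (simp add: direct_sum_def)
    then have "finite {i\<in>I. a \<odot>\<^bsub>M i\<^esub> x i \<noteq> \<zero>\<^bsub>M i\<^esub>}"
      by (rule rev_finite_subset) (use sm that in auto)
    then show ?thesis
      using that by (auto simp: direct_sum_def sm PiE_iff cong: conj_cong)
  qed
  have "abelian_group (direct_sum I M)"
  proof (rule abelian_groupI)
    show "\<zero>\<^bsub>direct_sum I M\<^esub> \<in> carrier (direct_sum I M)"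
      by (auto simp: direct_sum_def ag PiE_iff cong: conj_cong)
    fix x assume x: "x \<in> carrier (direct_sum I M)"
    show "\<zero>\<^bsub>direct_sum I M\<^esub> \<oplus>\<^bsub>direct_sum I M\<^esub> x = x"
      using x by (auto simp: direct_sum_def PiE_iff extensional_def ag)
    show "\<exists>y\<in>carrier (direct_sum I M). y \<oplus>\<^bsub>direct_sum I M\<^esub> x = \<zero>\<^bsub>direct_sum I M\<^esub>"
    proof (rule bexI[OF _ smult[OF _ x]])
      show "(\<ominus>\<^bsub>R\<^esub> \<one>\<^bsub>R\<^esub>) \<odot>\<^bsub>direct_sum I M\<^esub> x \<oplus>\<^bsub>direct_sum I M\<^esub> x = \<zero>\<^bsub>direct_sum I M\<^esub>"
        using x by (auto simp: direct_sum_def PiE_iff assms(2)[THEN left_module.minus_one_smult]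
            intro!: restrict_ext)
    qed simp
    fix y assume y: "y \<in> carrier (direct_sum I M)"
    show "x \<oplus>\<^bsub>direct_sum I M\<^esub> y = y \<oplus>\<^bsub>direct_sum I M\<^esub> x"
      using x y by (auto simp: direct_sum_def PiE_iff abelian_monoid.a_comm[OF g]
          intro!: restrict_ext)
    fix z assume z: "z \<in> carrier (direct_sum I M)"
    show "(x \<oplus>\<^bsub>direct_sum I M\<^esub> y) \<oplus>\<^bsub>direct_sum I M\<^esub> z
        = x \<oplus>\<^bsub>direct_sum I M\<^esub> (y \<oplus>\<^bsub>direct_sum I M\<^esub> z)"
      using x y z by (auto simp: direct_sum_def PiE_iff ag intro!: restrict_ext)
  qed (rule add)
  then show ?thesis
    by (intro left_module.intro left_module_axioms.intro smult)
      (auto simp: R.ring_axioms direct_sum_def PiE_iff extensional_def fun_eq_iff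
        assms(2)[THEN left_module.smult_l_distr] assms(2)[THEN left_module.smult_r_distr]
        assms(2)[THEN left_module.smult_assoc1] assms(2)[THEN left_module.smult_one])
qed

text \<open>
  The structure of \<open>M\<close> is moved along an injection \<open>c\<close> with left inverse \<open>d\<close>. Classes of modules range
  over modules on one fixed type, while a direct sum lives on a function type.
\<close>

definition transport ::
    "('p \<Rightarrow> 'm) \<Rightarrow> ('m \<Rightarrow> 'p) \<Rightarrow> ('r, 'p) module \<Rightarrow> ('r, 'm) module" where
  "transport c d M =
    \<lparr>carrier = c ` carrier M,
     mult = (\<lambda>x y. c (d x \<otimes>\<^bsub>M\<^esub> d y)),
     one = c \<one>\<^bsub>M\<^esub>,
     ring.zero = c \<zero>\<^bsub>M\<^esub>,
     add = (\<lambda>x y. c (d x \<oplus>\<^bsub>M\<^esub> d y)),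
     smult = (\<lambda>a x. c (a \<odot>\<^bsub>M\<^esub> d x))\<rparr>"

lemma left_module_transport:
  assumes "left_module R M" "\<And>x. x \<in> carrier M \<Longrightarrow> d (c x) = x"
  shows "left_module R (transport c d M)"
proof -
  interpret M: left_module R M by fact
  have "abelian_group (transport c d M)"
  proof (rule abelian_groupI)
    fix x assume x: "x \<in> carrier (transport c d M)"
    show "\<exists>y\<in>carrier (transport c d M). y \<oplus>\<^bsub>transport c d M\<^esub> x = \<zero>\<^bsub>transport c d M\<^esub>"
      by (rule bexI[of _ "c (\<ominus>\<^bsub>M\<^esub> d x)"])
        (use x in \<open>auto simp: transport_def assms(2) M.l_neg\<close>)
  qed (auto simp: transport_def assms(2) M.a_ac)
  then show ?thesis
    by (intro left_module.intro left_module_axioms.intro)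
      (auto simp: transport_def assms(2) M.smult_closed M.smult_l_distr M.smult_r_distr
        M.smult_assoc1 M.smult_one M.R.ring_axioms)
qed

section \<open>Small direct sums are small\<close>

lemma (in module_universe) Un_closed:
  assumes "A \<in> U" "B \<in> U"
  shows "A \<union> B \<in> U"
proof -
  obtain W where W: "W \<in> U" "infinite W" using infinite_mem by blast
  then obtain a b where ab: "a \<in> W" "b \<in> W" "a \<noteq> b"
    by (metis finite.simps infinite_imp_nonempty finite_subset insertCI subsetI)
  have "(\<Union>w\<in>{a, b}. if w = a then A else B) \<in> U"
    by (rule Union_closed) (use assms subset_closed[OF W(1), of "{a, b}"] ab in auto)
  moreover have "(\<Union>w\<in>{a, b}. if w = a then A else B) = A \<union> B" using ab by auto
  ultimately show ?thesis by simp
qed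

text \<open>
  A finitely supported family is determined by its graph over the support, which is a finite set of
  pairs; an infinite set has as many finite sets of pairs of elements as it has elements. This
  replaces the closure under products or power sets that a universe need not have.
\<close>

lemma (in module_universe) direct_sum_small:
  fixes M :: "'m \<Rightarrow> ('r, 'm) module"
  assumes "I \<in> U" "\<And>i. i \<in> I \<Longrightarrow> carrier (M i) \<in> U"
  obtains c :: "('m \<Rightarrow> 'm) \<Rightarrow> 'm"
    where "inj_on c (carrier (direct_sum I M))" "c ` carrier (direct_sum I M) \<in> U"
proof -
  obtain W where W: "W \<in> U" "infinite W" using infinite_mem by blast
  define V where "V = W \<union> (I \<union> (\<Union>i\<in>I. carrier (M i)))"
  have VU: "V \<in> U" unfolding V_def by (intro Un_closed Union_closed assms W)
  have inf: "infinite V" using W by (simp add: V_def)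
  define graph where "graph x = {(i, x i) | i. i \<in> I \<and> x i \<noteq> \<zero>\<^bsub>M i\<^esub>}" for x
  have "inj_on graph (carrier (direct_sum I M))"
  proof (rule inj_onI)
    fix x y assume xy: "x \<in> carrier (direct_sum I M)" "y \<in> carrier (direct_sum I M)" "graph x = graph y"
    have "x i = y i" if "i \<in> I" for i
    proof -
      have "(i, z) \<in> graph x \<longleftrightarrow> (i, z) \<in> graph y" for z using xy by simp
      from this[of "x i"] this[of "y i"] show ?thesis using that by (auto simp: graph_def)
    qed
    then show "x = y" using xy by (auto simp: direct_sum_def intro: PiE_ext)
  qed
  moreover have "graph ` carrier (direct_sum I M) \<subseteq> Fpow (V \<times> V)"
  proof (rule image_subsetI)
    fix x assume x: "x \<in> carrier (direct_sum I M)"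
    have "graph x = (\<lambda>i. (i, x i)) ` {i\<in>I. x i \<noteq> \<zero>\<^bsub>M i\<^esub>}" by (auto simp: graph_def)
    then have "finite (graph x)" using x by (simp add: direct_sum_def)
    moreover have "graph x \<subseteq> V \<times> V" using x by (auto simp: graph_def V_def direct_sum_def)
    ultimately show "graph x \<in> Fpow (V \<times> V)" by (simp add: Fpow_def)
  qed
  ultimately have "carrier (direct_sum I M) \<lesssim> Fpow (V \<times> V)" by (auto simp: lepoll_def)
  also have "Fpow (V \<times> V) \<approx> V \<times> V"
    using inf by (intro eqpoll_Fpow) (auto simp: finite_cartesian_product_iff)
  also have "V \<times> V \<approx> V"
    using card_of_Times_same_infinite[OF inf] by (simp add: eqpoll_iff_card_of_ordIso)
  finally obtain c where c: "inj_on c (carrier (direct_sum I M))" "c ` carrier (direct_sum I M) \<subseteq> V"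
    by (auto simp: lepoll_def)
  show ?thesis using that[OF c(1) subset_closed[OF VU c(2)]] .
qed

section \<open>From inverse limits of complexes to inverse limits of modules\<close>

text \<open>
  With the same module in all degrees, arguments about chain maps are uniform in the degree, and
  membership of the complex in \<open>complexes_in R U Xs\<close> is membership of the module in \<open>Xs\<close>; a complex
  concentrated in one degree would bring in the zero module as well.
\<close>

definition constant_complex :: "('r, 'm) module \<Rightarrow> ('r, 'm) chain_cplx" where
  "constant_complex M = \<lparr>cterm = (\<lambda>n. M), cdiff = (\<lambda>n. \<lambda>x\<in>carrier M. \<zero>\<^bsub>M\<^esub>)\<rparr>"

lemma is_complex_constant_complex:
  "M \<in> Ob (MOD R U) \<Longrightarrow> is_complex R U (constant_complex M)"
  using zero_in_module_hom[of R M M]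
  by (auto simp: is_complex_def constant_complex_def MOD_def left_module_def abelian_group_def
      abelian_monoid.zero_closed)

lemma module_hom_chain_map:
  assumes "M \<in> Ob (MOD R U)" "N \<in> Ob (MOD R U)" "f \<in> module_hom R M N"
  shows "(\<lambda>n. f) \<in> chain_maps R (constant_complex M) (constant_complex N)"
  using assms module_hom_zero[of R M N f] module_hom_closed[of f R M N]
  by (auto simp: chain_maps_def constant_complex_def MOD_def)

lemma chain_map_constant_complexD:
  assumes "f \<in> chain_maps R K (constant_complex M)" "x \<in> carrier (cterm K n)"
  shows "f (n - 1) (cdiff K n x) = \<zero>\<^bsub>M\<^esub>"
proof -
  have "f n \<in> module_hom R (cterm K n) M"
    using assms(1) by (simp add: chain_maps_def constant_complex_def)
  then have "f n x \<in> carrier M"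
    using module_hom_closed assms(2) by metis
  then show ?thesis
    using assms by (force simp: chain_maps_def constant_complex_def)
qed

text \<open>
  Since all differentials in the diagram vanish, a cone over it is, degree by degree, a cone of modules
  whose legs kill the boundaries. The induced maps into \<open>L\<close> form a chain map because they kill the
  boundaries as well, by uniqueness.
\<close>

lemma inverse_limit_constant_complex:
  assumes "is_inverse_limit (MOD R U) I r D u L \<pi>"
  shows "is_inverse_limit (CPLX R U) I r (\<lambda>i. constant_complex (D i)) (\<lambda>i j n. u i j)
    (constant_complex L) (\<lambda>i n. \<pi> i)"
proof -
  have sys: "inverse_system (MOD R U) I r D u" and cone: "is_cone (MOD R U) I r D u L \<pi>"
    using assms by (auto simp: is_inverse_limit_def)
  have univ: "\<exists>!h. h \<in> module_hom R T L \<and> (\<forall>i\<in>I. compose (carrier T) (\<pi> i) h = \<tau> i)"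
    if "is_cone (MOD R U) I r D u T \<tau>" for T \<tau>
    using assms that by (auto simp: is_inverse_limit_def MOD_def)
  have r: "i \<in> I" "j \<in> I" if "(i, j) \<in> r" for i j
    using sys that
    by (auto simp: inverse_system_def directed_poset_def partial_order_on_def preorder_on_def
        refl_on_def)
  have D: "D i \<in> Ob (MOD R U)" if "i \<in> I" for i
    using sys that by (auto simp: inverse_system_def)
  have L: "L \<in> Ob (MOD R U)" using cone by (simp add: is_cone_def)
  have pi: "\<pi> i \<in> module_hom R L (D i)" if "i \<in> I" for i
    using cone that by (auto simp: is_cone_def MOD_def)
  have u: "u i j \<in> module_hom R (D j) (D i)" if "(i, j) \<in> r" for i j
    using sys that by (auto simp: inverse_system_def MOD_def)
  have "inverse_system (CPLX R U) I r (\<lambda>i. constant_complex (D i)) (\<lambda>i j n. u i j)"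
    unfolding inverse_system_def
  proof (intro conjI)
    show "\<forall>(i, j)\<in>r. (\<lambda>n. u i j) \<in> Hom (CPLX R U) (constant_complex (D j)) (constant_complex (D i))"
      using module_hom_chain_map[OF D D u] r by (auto simp: CPLX_def)
    show "\<forall>i\<in>I. constant_complex (D i) \<in> Ob (CPLX R U)"
      using is_complex_constant_complex D by (auto simp: CPLX_def)
  qed (use sys in \<open>auto simp: inverse_system_def CPLX_def MOD_def
        constant_complex_def\<close>)
  moreover have "is_cone (CPLX R U) I r (\<lambda>i. constant_complex (D i)) (\<lambda>i j n. u i j)
    (constant_complex L) (\<lambda>i n. \<pi> i)"
    unfolding is_cone_def
  proof (intro conjI)
    show "\<forall>i\<in>I. (\<lambda>n. \<pi> i) \<in> Hom (CPLX R U) (constant_complex L) (constant_complex (D i))"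
      using module_hom_chain_map[OF L D pi] by (auto simp: CPLX_def)
    show "constant_complex L \<in> Ob (CPLX R U)"
      using is_complex_constant_complex[OF L] by (simp add: CPLX_def)
  qed (use cone in \<open>auto simp: is_cone_def CPLX_def MOD_def
        constant_complex_def\<close>)
  moreover have "\<exists>!h. h \<in> Hom (CPLX R U) T (constant_complex L) \<and>
      (\<forall>i\<in>I. Comp (CPLX R U) T (\<lambda>n. \<pi> i) h = \<tau> i)"
    if T: "is_cone (CPLX R U) I r (\<lambda>i. constant_complex (D i)) (\<lambda>i j n. u i j) T \<tau>" for T \<tau>
  proof -
    have Tcx: "is_complex R U T" using T by (simp add: is_cone_def CPLX_def)
    then have Tn: "cterm T n \<in> Ob (MOD R U)"
      and Td: "cdiff T n \<in> module_hom R (cterm T n) (cterm T (n - 1))" for n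
      by (auto simp: is_complex_def)
    have tau: "\<tau> i \<in> chain_maps R T (constant_complex (D i))" if "i \<in> I" for i
      using T that by (auto simp: is_cone_def CPLX_def)
    have cone_n: "is_cone (MOD R U) I r D u (cterm T n) (\<lambda>i. \<tau> i n)" for n
      unfolding is_cone_def
    proof (intro conjI ballI)
      show "\<tau> i n \<in> Hom (MOD R U) (cterm T n) (D i)" if "i \<in> I" for i
        using tau[OF that] by (auto simp: chain_maps_def MOD_def constant_complex_def)
      show "case p of (i, j) \<Rightarrow> Comp (MOD R U) (cterm T n) (u i j) (\<tau> j n) = \<tau> i n"
        if "p \<in> r" for p
        using T that by (auto simp: is_cone_def CPLX_def MOD_def dest!: fun_cong[of _ _ n] bspec[of r _ p])
    qed (rule Tn)
    obtain h where h: "\<And>n. h n \<in> module_hom R (cterm T n) L"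
      and hpi: "\<And>n i. i \<in> I \<Longrightarrow> compose (carrier (cterm T n)) (\<pi> i) (h n) = \<tau> i n"
      using univ[OF cone_n] by metis
    have huniq: "g = h n"
      if "g \<in> module_hom R (cterm T n) L" "\<And>i. i \<in> I \<Longrightarrow> compose (carrier (cterm T n)) (\<pi> i) g = \<tau> i n"
      for g n
      using univ[OF cone_n[of n]] that h hpi by blast
    \<comment> \<open>The composite of \<open>h\<close> with the differential of \<open>T\<close> is the map into \<open>L\<close> induced by the zero cone.\<close>
    have hd: "h (n - 1) (cdiff T n x) = \<zero>\<^bsub>L\<^esub>" if x: "x \<in> carrier (cterm T n)" for n x
    proof -
      let ?T = "cterm T n"
      let ?z = "\<lambda>i. \<lambda>x\<in>carrier ?T. \<zero>\<^bsub>D i\<^esub>"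
      have lm: "left_module R ?T" "left_module R L" "\<And>i. i \<in> I \<Longrightarrow> left_module R (D i)"
        using Tn L D by (auto simp: MOD_def)
      have pi0: "\<pi> i \<zero>\<^bsub>L\<^esub> = \<zero>\<^bsub>D i\<^esub>" if "i \<in> I" for i
        using module_hom_zero lm pi that by blast
      have u0: "u i j \<zero>\<^bsub>D j\<^esub> = \<zero>\<^bsub>D i\<^esub>" if "(i, j) \<in> r" for i j
        using module_hom_zero lm u r that by blast
      have "is_cone (MOD R U) I r D u ?T ?z"
        unfolding is_cone_def using Tn lm zero_in_module_hom[of R ?T] u0
        by (auto simp: MOD_def compose_def intro!: restrict_ext)
      moreover have "compose (carrier ?T) (h (n - 1)) (cdiff T n) \<in> module_hom R ?T L"
        using module_hom_compose[OF Td h lm(1)] .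
      moreover have "compose (carrier ?T) (\<pi> i) (compose (carrier ?T) (h (n - 1)) (cdiff T n)) = ?z i"
        if "i \<in> I" for i
      proof
        fix y
        have "\<pi> i (h (n - 1) (cdiff T n y)) = \<tau> i (n - 1) (cdiff T n y)" if "y \<in> carrier ?T"
          using hpi[OF \<open>i \<in> I\<close>, of "n - 1"] module_hom_closed[OF Td that] by (metis compose_eq)
        then show "compose (carrier ?T) (\<pi> i) (compose (carrier ?T) (h (n - 1)) (cdiff T n)) y = ?z i y"
          using chain_map_constant_complexD[OF tau[OF that]] by (simp add: compose_def)
      qed
      moreover have "(\<lambda>x\<in>carrier ?T. \<zero>\<^bsub>L\<^esub>) \<in> module_hom R ?T L"
        by (rule zero_in_module_hom[OF lm(1,2)])
      moreover have "compose (carrier ?T) (\<pi> i) (\<lambda>x\<in>carrier ?T. \<zero>\<^bsub>L\<^esub>) = ?z i" if "i \<in> I" for i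
        using pi0[OF that] by (auto simp: compose_def)
      ultimately have "compose (carrier ?T) (h (n - 1)) (cdiff T n) = (\<lambda>x\<in>carrier ?T. \<zero>\<^bsub>L\<^esub>)"
        using univ[of ?T ?z] by blast
      from fun_cong[OF this, of x] show ?thesis using x by (simp add: compose_eq)
    qed
    show ?thesis
    proof (intro ex1I[of _ h] conjI ballI)
      show "h \<in> Hom (CPLX R U) T (constant_complex L)"
        using h hd module_hom_closed[OF h] by (auto simp: CPLX_def chain_maps_def constant_complex_def)
      show "Comp (CPLX R U) T (\<lambda>n. \<pi> i) h = \<tau> i" if "i \<in> I" for i
        using hpi[OF that] by (auto simp: CPLX_def)
      show "g = h" if g: "g \<in> Hom (CPLX R U) T (constant_complex L) \<and>
        (\<forall>i\<in>I. Comp (CPLX R U) T (\<lambda>n. \<pi> i) g = \<tau> i)" for g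
      proof
        fix n
        show "g n = h n"
          by (rule huniq) (use g in \<open>auto simp: CPLX_def chain_maps_def constant_complex_def
              dest!: fun_cong[of _ _ n] bspec\<close>)
      qed
    qed
  qed
  ultimately show ?thesis by (auto simp: is_inverse_limit_def)
qed

lemma closed_under_inverse_limits_MOD:
  assumes "closed_under_inverse_limits U (CPLX R U) (complexes_in R U Xs)" "Xs \<subseteq> Ob (MOD R U)"
  shows "closed_under_inverse_limits U (MOD R U) Xs"
  unfolding closed_under_inverse_limits_def
proof (intro ballI allI impI)
  fix I r D u L \<pi>
  assume I: "I \<in> U" and lim: "is_inverse_limit (MOD R U) I r D u L \<pi>" and D: "\<forall>i\<in>I. D i \<in> Xs"
  have "constant_complex (D i) \<in> complexes_in R U Xs" if "i \<in> I" for i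
    using D that assms(2) is_complex_constant_complex[of "D i" R U]
    by (auto simp: complexes_in_def constant_complex_def)
  then have "constant_complex L \<in> complexes_in R U Xs"
    using assms(1) I inverse_limit_constant_complex[OF lim]
    unfolding closed_under_inverse_limits_def by blast
  then show "L \<in> Xs" by (simp add: complexes_in_def constant_complex_def)
qed

section \<open>Kernels as inverse limits\<close>

text \<open>
  The kernel is the intersection of the submodules \<open>S n\<close> of \<open>P\<close>, the direct sum of \<open>A\<close> and countably many
  copies of \<open>B\<close>, in which the first \<open>n\<close> coordinates from \<open>B\<close> equal the image under \<open>f\<close> of the
  coordinate \<open>x\<close> from \<open>A\<close>. It is essential that \<open>P\<close> is a direct sum and not a product: finite support
  forces \<open>f x = 0\<close> in the intersection.
\<close>

lemma kernel_closed:
  fixes Xs :: "('r, 'm) module set"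
  assumes "ring R" "module_universe U" "Xs \<subseteq> Ob (MOD R U)"
    and sums: "closed_under_direct_sums R U Xs"
    and limits: "closed_under_inverse_limits U (MOD R U) Xs"
    and A: "A \<in> Xs" and B: "B \<in> Xs" and f: "f \<in> module_hom R A B"
  shows "A\<lparr>carrier := {x \<in> carrier A. f x = \<zero>\<^bsub>B\<^esub>}\<rparr> \<in> Xs"
proof -
  interpret U: module_universe U by fact
  obtain W where W: "W \<in> U" "infinite W" using U.infinite_mem by blast
  then obtain e :: "nat \<Rightarrow> 'm" where e: "inj e" "range e \<subseteq> W"
    using infinite_countable_subset by blast
  define k where "k = inv_into UNIV e"
  have ke [simp]: "k (e n) = n" for n using e(1) by (simp add: k_def)
  have ee [simp]: "e m = e n \<longleftrightarrow> m = n" for m n using e(1) by (simp add: inj_eq)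
  define I where "I = range e"
  have I: "J \<in> U" if "J \<subseteq> I" for J using U.subset_closed[OF W(1)] e(2) that by (auto simp: I_def)
  have eI [simp]: "e n \<in> I" for n by (simp add: I_def)
  have lA: "left_module R A" and lB: "left_module R B" and cA: "carrier A \<in> U" and cB: "carrier B \<in> U"
    using A B assms(3) by (auto simp: MOD_def)
  interpret A: left_module R A by fact
  interpret B: left_module R B by fact
  note f_closed = module_hom_closed[OF f]
  \<comment> \<open>Index sets are sets of elements of the universe, so \<open>e\<close> copies the natural numbers into it;
    \<open>e 0\<close> is the index of \<open>A\<close> and \<open>e (Suc n)\<close> that of the \<open>n\<close>-th copy of \<open>B\<close>.\<close>
  define F where "F i = (if i = e 0 then A else B)" for i
  have F0 [simp]: "F (e 0) = A" and FS [simp]: "F (e (Suc n)) = B" for n by (auto simp: F_def)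
  have lF: "left_module R (F i)" for i using lA lB by (simp add: F_def)
  define P where "P = direct_sum I F"
  have lP: "left_module R P" unfolding P_def by (rule left_module_direct_sum[OF \<open>ring R\<close> lF])
  interpret P: left_module R P by fact
  obtain c where c: "inj_on c (carrier P)" "c ` carrier P \<in> U"
    unfolding P_def by (rule U.direct_sum_small[OF I[OF subset_refl]]) (auto simp: F_def cA cB)
  define d where "d = the_inv_into (carrier P) c"
  have dc [simp]: "d (c x) = x" if "x \<in> carrier P" for x
    using the_inv_into_f_f[OF c(1) that] by (simp add: d_def)
  have P_carrier: "x \<in> carrier P \<longleftrightarrow> x \<in> extensional I \<and> x (e 0) \<in> carrier A \<and>
      (\<forall>n. x (e (Suc n)) \<in> carrier B) \<and> finite {i\<in>I. x i \<noteq> \<zero>\<^bsub>F i\<^esub>}" for x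
  proof -
    have "(\<forall>i\<in>I. x i \<in> carrier (F i)) \<longleftrightarrow>
        x (e 0) \<in> carrier A \<and> (\<forall>n. x (e (Suc n)) \<in> carrier B)"
    proof -
      have "(\<forall>i\<in>I. x i \<in> carrier (F i)) \<longleftrightarrow> (\<forall>n. x (e n) \<in> carrier (F (e n)))"
        by (auto simp: I_def)
      also have "\<dots> \<longleftrightarrow> x (e 0) \<in> carrier A \<and> (\<forall>n. x (e (Suc n)) \<in> carrier B)"
        by (metis F0 FS not0_implies_Suc)
      finally show ?thesis .
    qed
    then show ?thesis by (auto simp: P_def direct_sum_def PiE_iff)
  qed
  have P0: "x (e 0) \<in> carrier A" if "x \<in> carrier P" for x using that by (simp add: P_carrier)
  have P_ops [simp]: "(x \<oplus>\<^bsub>P\<^esub> y) (e n) = x (e n) \<oplus>\<^bsub>F (e n)\<^esub> y (e n)"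
      "(a \<odot>\<^bsub>P\<^esub> x) (e n) = a \<odot>\<^bsub>F (e n)\<^esub> x (e n)" "\<zero>\<^bsub>P\<^esub> (e n) = \<zero>\<^bsub>F (e n)\<^esub>" for x y a n
    by (auto simp: P_def direct_sum_def)
  define S where "S n = {x \<in> carrier P. \<forall>m<n. x (e (Suc m)) = f (x (e 0))}" for n
  have SP: "x \<in> carrier P" if "x \<in> S n" for x n using that by (simp add: S_def)
  have S_anti: "S n \<subseteq> S m" if "m \<le> n" for m n using that by (auto simp: S_def)
  have lS: "left_module R (P\<lparr>carrier := S n\<rparr>)" for n
  proof (rule left_module_submodule[OF lP])
    show "x \<oplus>\<^bsub>P\<^esub> y \<in> S n" if "x \<in> S n" "y \<in> S n" for x y
      using that P.a_closed by (auto simp: S_def P0 module_hom_add[OF f])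
    show "a \<odot>\<^bsub>P\<^esub> x \<in> S n" if "a \<in> carrier R" "x \<in> S n" for a x
      using that P.smult_closed by (auto simp: S_def P0 module_hom_smult[OF f])
  qed (auto simp: S_def module_hom_zero[OF lA lB f])
  define D where "D n = transport c d (P\<lparr>carrier := S n\<rparr>)" for n
  have lD: "left_module R (D n)" for n
    unfolding D_def by (rule left_module_transport[OF lS]) (simp add: SP)
  have D_carrier: "carrier (D n) = c ` S n" for n by (simp add: D_def transport_def)
  have D_Ob: "D n \<in> Ob (MOD R U)" for n
  proof -
    have "carrier (D n) \<in> U"
      unfolding D_carrier by (rule U.subset_closed[OF c(2) image_mono]) (auto simp: SP)
    then show ?thesis using lD by (simp add: MOD_def)
  qed
  have D_add: "x \<oplus>\<^bsub>D n\<^esub> y = c (d x \<oplus>\<^bsub>P\<^esub> d y)" for x y n by (simp add: D_def transport_def)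
  have D_smult: "a \<odot>\<^bsub>D n\<^esub> x = c (a \<odot>\<^bsub>P\<^esub> d x)" for a x n by (simp add: D_def transport_def)
  have D_Xs: "D n \<in> Xs" for n
  proof -
    \<comment> \<open>On \<open>S n\<close> the coordinates outside \<open>J\<close> are determined by the coordinate at \<open>e 0\<close>.\<close>
    define J where "J = I - e ` {0<..n}"
    have JI: "J \<subseteq> I" and J0: "e 0 \<in> J" by (auto simp: J_def)
    have JS: "e (Suc m) \<in> J \<longleftrightarrow> n \<le> m" for m by (auto simp: J_def)
    define fill where "fill z = (\<lambda>i\<in>I. if i \<in> J then z i else f (z (e 0)))" for z
    have rest: "restrict x J \<in> carrier (direct_sum J F)" if "x \<in> S n" for x
    proof -
      have "finite {i\<in>I. x i \<noteq> \<zero>\<^bsub>F i\<^esub>}" using SP[OF that] by (simp add: P_carrier)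
      then have "finite {i\<in>J. x i \<noteq> \<zero>\<^bsub>F i\<^esub>}" by (rule rev_finite_subset) (use JI in auto)
      then show ?thesis
        using SP[OF that] JI by (auto simp: direct_sum_def P_def PiE_iff cong: conj_cong)
    qed
    have fillS: "fill z \<in> S n" if z: "z \<in> carrier (direct_sum J F)" for z
    proof -
      have zF: "z i \<in> carrier (F i)" if "i \<in> J" for i using z that by (auto simp: direct_sum_def)
      have z0: "z (e 0) \<in> carrier A" using zF[OF J0] by simp
      have "finite ({i\<in>J. z i \<noteq> \<zero>\<^bsub>F i\<^esub>} \<union> e ` {0<..n})" using z by (simp add: direct_sum_def)
      then have "finite {i\<in>I. fill z i \<noteq> \<zero>\<^bsub>F i\<^esub>}"
        by (rule rev_finite_subset) (auto simp: fill_def J_def)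
      then show ?thesis
        using z0 zF[of "e (Suc _)"] f_closed[OF z0] by (auto simp: S_def P_carrier fill_def J0 JS)
    qed
    have fr: "fill (restrict x J) = x" if "x \<in> S n" for x
    proof
      fix i
      have "x i = f (x (e 0))" if "i \<in> I" "i \<notin> J"
      proof -
        have "i \<in> e ` {0<..n}" using that by (simp add: J_def)
        then obtain m where "0 < m" "m \<le> n" "i = e m" by auto
        then show ?thesis using \<open>x \<in> S n\<close> by (cases m) (auto simp: S_def)
      qed
      moreover have "x i = undefined" if "i \<notin> I"
        using SP[OF \<open>x \<in> S n\<close>] that by (auto simp: P_carrier extensional_def)
      ultimately show "fill (restrict x J) i = x i" by (auto simp: fill_def J0)
    qed
    have rf: "restrict (fill z) J = z" if "z \<in> carrier (direct_sum J F)" for z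
      using that JI by (auto simp: fill_def fun_eq_iff direct_sum_def PiE_iff extensional_def)
    let ?g = "\<lambda>y\<in>carrier (D n). restrict (d y) J"
    have "?g \<in> module_hom R (D n) (direct_sum J F)"
    proof -
      interpret D: left_module R "D n" by (rule lD)
      have "restrict (x \<oplus>\<^bsub>P\<^esub> y) J = restrict x J \<oplus>\<^bsub>direct_sum J F\<^esub> restrict y J"
          "restrict (a \<odot>\<^bsub>P\<^esub> x) J = a \<odot>\<^bsub>direct_sum J F\<^esub> restrict x J" for a x y
        using JI by (auto simp: P_def direct_sum_def fun_eq_iff)
      moreover have "d (x \<oplus>\<^bsub>D n\<^esub> y) = d x \<oplus>\<^bsub>P\<^esub> d y"
        if "x \<in> carrier (D n)" "y \<in> carrier (D n)" for x y
        using that by (auto simp: D_add D_carrier SP)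
      moreover have "d (a \<odot>\<^bsub>D n\<^esub> x) = a \<odot>\<^bsub>P\<^esub> d x"
        if "a \<in> carrier R" "x \<in> carrier (D n)" for a x
        using that by (auto simp: D_smult D_carrier SP P.smult_closed)
      moreover have "restrict (d x) J \<in> carrier (direct_sum J F)" if "x \<in> carrier (D n)" for x
        using that rest by (auto simp: D_carrier SP)
      ultimately show ?thesis
        using D.a_closed D.smult_closed by (simp add: module_hom_def)
    qed
    moreover have "bij_betw ?g (carrier (D n)) (carrier (direct_sum J F))"
      by (rule bij_betw_byWitness[of _ "\<lambda>z. c (fill z)"])
        (auto simp: D_carrier SP SP[OF fillS] fr rf fillS rest)
    ultimately have "module_iso R (D n) (direct_sum J F)" unfolding module_iso_def by blast
    moreover have "\<forall>i\<in>J. F i \<in> Xs" using A B by (simp add: F_def)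
    ultimately show ?thesis
      using sums I[OF JI] D_Ob[of n] unfolding closed_under_direct_sums_def by blast
  qed
  define L where "L = A\<lparr>carrier := {x \<in> carrier A. f x = \<zero>\<^bsub>B\<^esub>}\<rparr>"
  have lL: "left_module R L" unfolding L_def by (rule left_module_kernel[OF lA lB f])
  have L_Ob: "L \<in> Ob (MOD R U)"
    using lL U.subset_closed[OF cA] by (auto simp: MOD_def L_def)
  have L_carrier: "x \<in> carrier L \<longleftrightarrow> x \<in> carrier A \<and> f x = \<zero>\<^bsub>B\<^esub>" for x by (simp add: L_def)
  \<comment> \<open>The inclusion of the kernel in \<open>P\<close> as its first summand.\<close>
  define emb where "emb x = (\<lambda>i\<in>I. if i = e 0 then x else \<zero>\<^bsub>B\<^esub>)" for x
  have embS: "emb x \<in> S n" if "x \<in> carrier L" for x n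
  proof -
    have "finite {i\<in>I. emb x i \<noteq> \<zero>\<^bsub>F i\<^esub>}"
      by (rule finite_subset[of _ "{e 0}"]) (auto simp: emb_def F_def)
    then show ?thesis using that by (auto simp: S_def P_carrier emb_def L_carrier)
  qed
  have emb0: "emb x (e 0) = x" for x by (simp add: emb_def)
  have S_Inter: "x (e 0) \<in> carrier L \<and> x = emb (x (e 0))" if x: "\<And>n. x \<in> S n" for x
  proof -
    have xP: "x \<in> carrier P" using SP[OF x] .
    have xS: "x (e (Suc m)) = f (x (e 0))" for m using x[of "Suc m"] by (simp add: S_def)
    \<comment> \<open>A nonzero value would occur at infinitely many coordinates.\<close>
    have f0: "f (x (e 0)) = \<zero>\<^bsub>B\<^esub>"
    proof (rule ccontr)
      assume "f (x (e 0)) \<noteq> \<zero>\<^bsub>B\<^esub>"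
      then have "e ` range Suc \<subseteq> {i\<in>I. x i \<noteq> \<zero>\<^bsub>F i\<^esub>}" by (auto simp: xS)
      moreover have "infinite (e ` range Suc)"
        using finite_imageD[of e "range Suc"] e(1)
        by (meson finite_imageD infinite_UNIV_nat inj_Suc inj_on_subset subset_UNIV)
      ultimately show False using xP finite_subset by (auto simp: P_carrier)
    qed
    have x_emb: "x i = emb (x (e 0)) i" for i
    proof (cases "i \<in> I")
      case True
      then obtain n where "i = e n" by (auto simp: I_def)
      then show ?thesis using xS f0 by (cases n) (auto simp: emb_def)
    qed (use xP in \<open>auto simp: P_carrier emb_def extensional_def\<close>)
    have "x (e 0) \<in> carrier L" using P0[OF xP] f0 by (simp add: L_carrier)
    moreover have "x = emb (x (e 0))" using x_emb by (rule ext)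
    ultimately show ?thesis by (rule conjI)
  qed
  define r where "r = {(i, j). i \<in> I \<and> j \<in> I \<and> k i \<le> k j}"
  define u where "u i j = (\<lambda>x\<in>carrier (D (k j)). x)" for i j :: 'm
  define \<pi> where "\<pi> i = (\<lambda>x\<in>carrier L. c (emb x))" for i :: 'm
  have D_mono: "carrier (D n) \<subseteq> carrier (D m)" if "m \<le> n" for m n
    using S_anti[OF that] by (auto simp: D_carrier)
  have u_hom: "u i j \<in> module_hom R (D (k j)) (D (k i))" if "k i \<le> k j" for i j
  proof -
    interpret D: left_module R "D (k j)" by (rule lD)
    show ?thesis using D_mono[OF that] D.a_closed D.smult_closed
      by (auto simp: module_hom_def u_def D_add D_smult)
  qed
  have "directed_poset I r"
  proof -
    have "antisym r" by (rule antisymI) (auto simp: r_def I_def)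
    then have "partial_order_on I r"
      by (auto simp: partial_order_on_def preorder_on_def refl_on_def trans_def r_def)
    moreover have "\<exists>l\<in>I. (i, l) \<in> r \<and> (j, l) \<in> r" if "i \<in> I" "j \<in> I" for i j
      using that by (intro bexI[of _ "e (max (k i) (k j))"]) (simp_all add: r_def)
    ultimately show ?thesis using eI unfolding directed_poset_def by blast
  qed
  then have sys: "inverse_system (MOD R U) I r (D \<circ> k) u"
    unfolding inverse_system_def using D_Ob u_hom D_mono
    by (auto simp: MOD_def r_def) (auto simp: u_def compose_def fun_eq_iff subset_iff)
  have pi_hom: "\<pi> i \<in> module_hom R L (D n)" for i n
  proof -
    interpret L: left_module R L by (rule lL)
    have "emb (x \<oplus>\<^bsub>L\<^esub> y) = emb x \<oplus>\<^bsub>P\<^esub> emb y" for x y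
      by (auto simp: emb_def P_def direct_sum_def L_def F_def fun_eq_iff)
    moreover have "emb (a \<odot>\<^bsub>L\<^esub> x) = a \<odot>\<^bsub>P\<^esub> emb x" if "a \<in> carrier R" for a x
      using that by (auto simp: emb_def P_def direct_sum_def L_def F_def fun_eq_iff B.smult_zero_right)
    ultimately show ?thesis
      using embS SP[OF embS] L.smult_closed
      by (auto simp: module_hom_def \<pi>_def D_carrier D_add D_smult)
  qed
  have cone: "is_cone (MOD R U) I r (D \<circ> k) u L \<pi>"
    using L_Ob pi_hom embS unfolding is_cone_def
    by (auto simp: MOD_def) (auto simp: u_def \<pi>_def compose_def fun_eq_iff D_carrier)
  have "is_inverse_limit (MOD R U) I r (D \<circ> k) u L \<pi>"
    unfolding is_inverse_limit_def
  proof (intro conjI sys cone allI impI)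
    fix T \<tau> assume T: "is_cone (MOD R U) I r (D \<circ> k) u T \<tau>"
    then have lT: "left_module R T" by (simp add: is_cone_def MOD_def)
    interpret T: left_module R T by fact
    have tau: "\<tau> (e n) \<in> module_hom R T (D n)" for n
      using T by (auto simp: is_cone_def MOD_def dest!: bspec[of I _ "e n"])
    have tau_eq: "\<tau> (e n) t = \<tau> (e 0) t" if t: "t \<in> carrier T" for n t
    proof -
      have "compose (carrier T) (u (e 0) (e n)) (\<tau> (e n)) = \<tau> (e 0)"
        using T by (auto simp: is_cone_def MOD_def r_def)
      from fun_cong[OF this, of t] show ?thesis
        using module_hom_closed[OF tau t] t by (simp add: compose_eq u_def)
    qed
    \<comment> \<open>The legs of the cone agree as maps into \<open>P\<close>, so \<open>p\<close> takes values in the intersection of all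
      \<open>S n\<close>, that is, in the embedded kernel.\<close>
    define p where "p t = d (\<tau> (e 0) t)" for t
    have pS: "p t \<in> S n" and cp: "c (p t) = \<tau> (e n) t" if t: "t \<in> carrier T" for t n
      using module_hom_closed[OF tau[of n] t] tau_eq[OF t, of n] SP
      by (auto simp: p_def D_carrier)
    define h where "h = (\<lambda>t\<in>carrier T. p t (e 0))"
    have hL: "h t \<in> carrier L" and ph: "p t = emb (h t)" if "t \<in> carrier T" for t
      using S_Inter[of "p t"] pS that by (auto simp: h_def)
    have "h \<in> module_hom R T L"
    proof -
      have "p (t \<oplus>\<^bsub>T\<^esub> t') = p t \<oplus>\<^bsub>P\<^esub> p t'" if "t \<in> carrier T" "t' \<in> carrier T" for t t'
        using that module_hom_add[OF tau[of 0]] SP[OF pS] by (simp add: p_def D_add)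
      moreover have "p (a \<odot>\<^bsub>T\<^esub> t) = a \<odot>\<^bsub>P\<^esub> p t" if "a \<in> carrier R" "t \<in> carrier T" for a t
        using that module_hom_smult[OF tau[of 0]] P.smult_closed SP[OF pS] by (simp add: p_def D_smult)
      ultimately show ?thesis
        using hL T.smult_closed by (auto simp: module_hom_def h_def L_def)
    qed
    moreover have "compose (carrier T) (\<pi> i) h = \<tau> i" if "i \<in> I" for i
    proof -
      obtain n where i: "i = e n" using \<open>i \<in> I\<close> unfolding I_def by blast
      show ?thesis unfolding i
        by (rule module_hom_ext[OF module_hom_compose[OF \<open>h \<in> module_hom R T L\<close> pi_hom lT] tau])
          (simp add: compose_eq \<pi>_def hL ph[symmetric] cp)
    qed
    moreover have "g = h"
      if g: "g \<in> module_hom R T L" "\<forall>i\<in>I. compose (carrier T) (\<pi> i) g = \<tau> i" for g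
    proof (rule module_hom_ext[OF g(1) \<open>h \<in> module_hom R T L\<close>])
      fix t assume t: "t \<in> carrier T"
      have "c (emb (g t)) = \<tau> (e 0) t"
        using fun_cong[OF bspec[OF g(2) eI[of 0]], of t] t module_hom_closed[OF g(1) t]
        by (simp add: compose_eq \<pi>_def)
      also have "\<dots> = c (emb (h t))" using cp[OF t, of 0] ph[OF t] by simp
      finally have "emb (g t) = emb (h t)"
        using dc SP[OF embS] module_hom_closed[OF g(1) t] hL[OF t] by metis
      then show "g t = h t" using emb0 by metis
    qed
    ultimately have "\<exists>!h. h \<in> module_hom R T L \<and> (\<forall>i\<in>I. compose (carrier T) (\<pi> i) h = \<tau> i)"
      by (intro ex1I[of _ h]) blast+
    then show "\<exists>!h. h \<in> Hom (MOD R U) T L \<and> (\<forall>i\<in>I. Comp (MOD R U) T (\<pi> i) h = \<tau> i)"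
      by (simp add: MOD_def)
  qed
  moreover have "\<forall>i\<in>I. (D \<circ> k) i \<in> Xs" using D_Xs by simp
  ultimately have "L \<in> Xs"
    using limits I[OF subset_refl] unfolding closed_under_inverse_limits_def by blast
  then show ?thesis by (simp add: L_def)
qed

section \<open>Envelopes are reflections\<close>

lemma envelope_extend:
  assumes "is_envelope (MOD R U) Xs M X \<phi>" "Y \<in> Xs" "f \<in> module_hom R M Y"
  obtains g where "g \<in> module_hom R X Y" "compose (carrier M) g \<phi> = f"
proof -
  have "\<forall>Y\<in>Xs. \<forall>f\<in>module_hom R M Y. \<exists>g\<in>module_hom R X Y. compose (carrier M) g \<phi> = f"
    using assms(1) by (simp add: is_envelope_def is_preenvelope_def MOD_def)
  then show ?thesis using assms(2,3) that by blast
qed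

text \<open>
  The maps \<open>a\<close> and \<open>b\<close> agree on the submodule \<open>E\<close> through which \<open>\<phi>\<close> factors. An extension of \<open>\<phi>\<close>
  along itself with values in \<open>E\<close> is an automorphism of \<open>X\<close>, so \<open>E\<close> is all of \<open>X\<close>.
\<close>

lemma envelope_factorisation_unique:
  assumes "Xs \<subseteq> Ob (MOD R U)"
    and kernels: "\<forall>A\<in>Xs. \<forall>B\<in>Xs. \<forall>f\<in>module_hom R A B.
      A\<lparr>carrier := {x \<in> carrier A. f x = \<zero>\<^bsub>B\<^esub>}\<rparr> \<in> Xs"
    and M: "left_module R M"
    and env: "is_envelope (MOD R U) Xs M X \<phi>"
    and Y: "Y \<in> Xs" and a: "a \<in> module_hom R X Y" and b: "b \<in> module_hom R X Y"
    and eq: "\<And>x. x \<in> carrier M \<Longrightarrow> a (\<phi> x) = b (\<phi> x)"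
  shows "a = b"
proof -
  have X: "X \<in> Xs" and \<phi>: "\<phi> \<in> module_hom R M X"
    using env by (auto simp: is_envelope_def is_preenvelope_def MOD_def)
  have lX: "left_module R X" and lY: "left_module R Y" using X Y assms(1) by (auto simp: MOD_def)
  interpret Y: left_module R Y by fact
  let ?D = "\<lambda>x\<in>carrier X. a x \<ominus>\<^bsub>Y\<^esub> b x"
  define E where "E = X\<lparr>carrier := {x \<in> carrier X. ?D x = \<zero>\<^bsub>Y\<^esub>}\<rparr>"
  have E: "E \<in> Xs" unfolding E_def using kernels X Y module_hom_diff[OF lX lY a b] by blast
  have E_ops: "x \<oplus>\<^bsub>E\<^esub> y = x \<oplus>\<^bsub>X\<^esub> y" "c \<odot>\<^bsub>E\<^esub> x = c \<odot>\<^bsub>X\<^esub> x" for c x y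
    by (simp_all add: E_def)
  have EX: "carrier E \<subseteq> carrier X" by (auto simp: E_def)
  note \<phi>X = module_hom_closed[OF \<phi>]
  have "\<phi> x \<in> carrier E" if "x \<in> carrier M" for x
    using that eq \<phi>X module_hom_closed[OF b] by (simp add: E_def Y.minus_eq_zero_iff)
  then have "\<phi> \<in> module_hom R M E" using \<phi> by (auto simp: module_hom_def E_ops)
  then obtain s where s: "s \<in> module_hom R X E" "compose (carrier M) s \<phi> = \<phi>"
    by (rule envelope_extend[OF env E])
  have "s \<in> module_hom R X X" using s(1) EX by (auto simp: module_hom_def E_ops)
  then have "automorphism (MOD R U) X s" using env s(2) by (auto simp: is_envelope_def MOD_def)
  then obtain t where t: "t \<in> module_hom R X X" "compose (carrier X) s t = (\<lambda>x\<in>carrier X. x)"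
    by (auto simp: automorphism_def MOD_def)
  show ?thesis
  proof (rule module_hom_ext[OF a b])
    fix x assume x: "x \<in> carrier X"
    have "s (t x) = x" using fun_cong[OF t(2), of x] x by (simp add: compose_eq)
    then have "x \<in> carrier E" using module_hom_closed[OF s(1) module_hom_closed[OF t(1) x]] by simp
    then show "a x = b x"
      using x module_hom_closed[OF a x] module_hom_closed[OF b x]
      by (simp add: E_def Y.minus_eq_zero_iff)
  qed
qed

section \<open>Envelopes of complexes, term by term\<close>

theorem theorem2p10:
  fixes R :: "('r, 'k) ring_scheme"
    and U :: "'m set set"
    and Xs :: "('r, 'm) module set"
  assumes "ring R"
    and "module_universe U"
    and "Xs \<subseteq> Ob (MOD R U)"
    and "closed_under_direct_sums R U Xs"
    and "closed_under_direct_summands R U Xs"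
    and "closed_under_extensions R U Xs"
    and "closed_under_inverse_limits U (CPLX R U) (complexes_in R U Xs)"
    and "closed_under_direct_limits U (CPLX R U) (complexes_in R U Xs)"
    and "\<forall>M \<in> Ob (MOD R U). has_envelope (MOD R U) Xs M"
  shows "\<forall>K \<in> Ob (CPLX R U). has_envelope (CPLX R U) (complexes_in R U Xs) K"
proof
  fix K assume "K \<in> Ob (CPLX R U)"
  then have K: "cterm K n \<in> Ob (MOD R U)" "cdiff K n \<in> module_hom R (cterm K n) (cterm K (n - 1))"
    "x \<in> carrier (cterm K n) \<Longrightarrow> cdiff K (n - 1) (cdiff K n x) = \<zero>\<^bsub>cterm K (n - 1 - 1)\<^esub>" for n x
    by (auto simp: CPLX_def is_complex_def)
  have lK: "left_module R (cterm K n)" for n using K(1) by (simp add: MOD_def)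
  have "\<forall>n. \<exists>X \<phi>. is_envelope (MOD R U) Xs (cterm K n) X \<phi>"
    using assms(9) K(1) by (auto simp: has_envelope_def)
  then obtain X where "\<forall>n. \<exists>\<phi>. is_envelope (MOD R U) Xs (cterm K n) (X n) \<phi>"
    by (auto dest: choice)
  then obtain \<phi> where env: "\<And>n. is_envelope (MOD R U) Xs (cterm K n) (X n) (\<phi> n)"
    by metis
  have X: "X n \<in> Xs" and \<phi>: "\<phi> n \<in> module_hom R (cterm K n) (X n)" for n
    using env[of n] by (auto simp: is_envelope_def is_preenvelope_def MOD_def)
  have lX: "left_module R (X n)" for n using X assms(3) by (auto simp: MOD_def)
  note limits = closed_under_inverse_limits_MOD[OF assms(7,3)]
  have kernels: "\<forall>A\<in>Xs. \<forall>B\<in>Xs. \<forall>f\<in>module_hom R A B.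
      A\<lparr>carrier := {x \<in> carrier A. f x = \<zero>\<^bsub>B\<^esub>}\<rparr> \<in> Xs"
    using kernel_closed[OF assms(1-4) limits] by blast
  note unique = envelope_factorisation_unique[OF assms(3) kernels lK env]
  have extend: "\<exists>g \<in> module_hom R (X n) Y. \<forall>x\<in>carrier (cterm K n). g (\<phi> n x) = f x"
    if "Y \<in> Xs" "f \<in> module_hom R (cterm K n) Y" for n Y f
  proof -
    obtain g where g: "g \<in> module_hom R (X n) Y" "compose (carrier (cterm K n)) g (\<phi> n) = f"
      by (rule envelope_extend[OF env \<open>Y \<in> Xs\<close> \<open>f \<in> _\<close>])
    then show ?thesis by (metis compose_eq)
  qed
  have "\<exists>d. \<forall>n. d n \<in> module_hom R (X n) (X (n - 1)) \<and>
      (\<forall>x\<in>carrier (cterm K n). d n (\<phi> n x) = compose (carrier (cterm K n)) (\<phi> (n - 1)) (cdiff K n) x)"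
    using extend[OF X module_hom_compose[OF K(2) \<phi> lK]] by metis
  then obtain d where d: "\<And>n. d n \<in> module_hom R (X n) (X (n - 1))"
    and d\<phi>: "\<And>n x. x \<in> carrier (cterm K n) \<Longrightarrow> d n (\<phi> n x) = \<phi> (n - 1) (cdiff K n x)"
    by (auto simp: compose_eq)
  define L where "L = \<lparr>cterm = X, cdiff = d\<rparr>"
  have "d (n - 1) (d n x) = \<zero>\<^bsub>X (n - 1 - 1)\<^esub>" if x: "x \<in> carrier (X n)" for n x
  proof -
    have "compose (carrier (X n)) (d (n - 1)) (d n) = (\<lambda>x\<in>carrier (X n). \<zero>\<^bsub>X (n - 1 - 1)\<^esub>)"
    proof (rule unique[OF X module_hom_compose[OF d d lX] zero_in_module_hom[OF lX lX]])
      fix y assume y: "y \<in> carrier (cterm K n)"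
      have "d (n - 1) (d n (\<phi> n y)) = \<phi> (n - 1 - 1) (cdiff K (n - 1) (cdiff K n y))"
        using d\<phi> y module_hom_closed[OF K(2) y] by simp
      also have "\<dots> = \<zero>\<^bsub>X (n - 1 - 1)\<^esub>"
        using K(3)[OF y] module_hom_zero[OF lK lX \<phi>] by simp
      finally show "compose (carrier (X n)) (d (n - 1)) (d n) (\<phi> n y) =
          (\<lambda>x\<in>carrier (X n). \<zero>\<^bsub>X (n - 1 - 1)\<^esub>) (\<phi> n y)"
        using module_hom_closed[OF \<phi> y] by (simp add: compose_eq)
    qed
    from fun_cong[OF this, of x] show ?thesis using x by (simp add: compose_eq)
  qed
  then have L: "L \<in> complexes_in R U Xs"
    using X assms(3) d by (auto simp: L_def complexes_in_def is_complex_def)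
  have \<phi>L: "\<phi> \<in> chain_maps R K L"
    using \<phi> d\<phi> by (auto simp: chain_maps_def L_def)
  have "\<exists>g\<in>chain_maps R L Y. (\<lambda>n. compose (carrier (cterm K n)) (g n) (\<phi> n)) = f"
    if Y: "Y \<in> complexes_in R U Xs" and f: "f \<in> chain_maps R K Y" for Y f
  proof -
    have YX: "cterm Y n \<in> Xs" and dY: "cdiff Y n \<in> module_hom R (cterm Y n) (cterm Y (n - 1))" for n
      using Y by (auto simp: complexes_in_def is_complex_def)
    have fn: "f n \<in> module_hom R (cterm K n) (cterm Y n)" for n using f by (simp add: chain_maps_def)
    obtain g where g: "\<And>n. g n \<in> module_hom R (X n) (cterm Y n)"
      and g\<phi>: "\<And>n x. x \<in> carrier (cterm K n) \<Longrightarrow> g n (\<phi> n x) = f n x"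
      using extend[OF YX fn] by metis
    have "cdiff Y n (g n x) = g (n - 1) (d n x)" if x: "x \<in> carrier (X n)" for n x
    proof -
      have "compose (carrier (X n)) (cdiff Y n) (g n) = compose (carrier (X n)) (g (n - 1)) (d n)"
      proof (rule unique[OF YX module_hom_compose[OF g dY lX] module_hom_compose[OF d g lX]])
        fix y assume y: "y \<in> carrier (cterm K n)"
        have "cdiff Y n (g n (\<phi> n y)) = g (n - 1) (d n (\<phi> n y))"
          using f y g\<phi> d\<phi> module_hom_closed[OF K(2) y] by (simp add: chain_maps_def)
        then show "compose (carrier (X n)) (cdiff Y n) (g n) (\<phi> n y) =
            compose (carrier (X n)) (g (n - 1)) (d n) (\<phi> n y)"
          using module_hom_closed[OF \<phi> y] by (simp add: compose_eq)
      qed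
      from fun_cong[OF this, of x] show ?thesis using x by (simp add: compose_eq)
    qed
    then have "g \<in> chain_maps R L Y" using g by (simp add: chain_maps_def L_def)
    moreover have "compose (carrier (cterm K n)) (g n) (\<phi> n) = f n" for n
      by (rule module_hom_ext[OF module_hom_compose[OF \<phi> g lK] fn]) (simp add: compose_eq g\<phi>)
    ultimately show ?thesis by (intro bexI[of _ g]) auto
  qed
  then have pre: "is_preenvelope (CPLX R U) (complexes_in R U Xs) K L \<phi>"
    using L \<phi>L by (simp add: is_preenvelope_def CPLX_def)
  have id: "Ident (CPLX R U) L \<in> Hom (CPLX R U) L L"
    using is_category.Ident_Hom[OF is_category_CPLX] L by (auto simp: CPLX_def complexes_in_def)
  have "automorphism (CPLX R U) L g"
    if g: "g \<in> Hom (CPLX R U) L L" "Comp (CPLX R U) K g \<phi> = \<phi>" for g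
  proof -
    have "g n = Ident (CPLX R U) L n" for n
    proof (rule unique[OF X])
      fix y assume y: "y \<in> carrier (cterm K n)"
      have "compose (carrier (cterm K n)) (g n) (\<phi> n) = \<phi> n"
        using g(2) by (auto simp: CPLX_def dest: fun_cong[of _ _ n])
      from fun_cong[OF this, of y] show "g n (\<phi> n y) = Ident (CPLX R U) L n (\<phi> n y)"
        using y module_hom_closed[OF \<phi> y] by (simp add: compose_eq CPLX_def L_def)
    qed (use g(1) id in \<open>auto simp: CPLX_def chain_maps_def L_def\<close>)
    then have "g = Ident (CPLX R U) L" by blast
    then show ?thesis
      using id is_category.Comp_Ident[OF is_category_CPLX _ _ id] L
      by (auto simp: automorphism_def CPLX_def complexes_in_def)
  qed
  then have "is_envelope (CPLX R U) (complexes_in R U Xs) K L \<phi>"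
    using pre by (simp add: is_envelope_def)
  then show "has_envelope (CPLX R U) (complexes_in R U Xs) K"
    unfolding has_envelope_def by blast
qed

end
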